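(* Consider continuous 3-player Guts. There is a fixed $\delta>0$ such that for all sufficiently large $C>0$ and all sufficiently small $\varepsilon>0$ (depending on $C$) the following holds. Let $A$ be the joint pure strategy $p_2^*=p_3^*=1/\sqrt2-\varepsilon$ and $B$ the joint pure strategy $(p_2^*,p_3^* )=(0,\,1/\sqrt2+\delta)$ of players 2-3. Then the mixed strategy $(1-C\varepsilon^2)A+C\varepsilon^2B$ (play $A$ with probability $1-C\varepsilon^2$ and $B$ with probability $C\varepsilon^2$) returns $\alpha<0$ and $\beta\le\beta_0$, for some constant $\beta_0<1$, for all $p_1^*\in[0,1]$; and therefore it is a winning strategy for players 2-3.
   Context: Continuous 3-player Guts: players 1, 2, 3 receive independent hands $p_1,p_2,p_3$ uniform on $[0,1]$. A pure strategy of player $i$ is a threshold $p_i^*\in[0,1]$: hold if $p_i\ge p_i^*$, drop if $p_i<p_i^*$. Each ante is one unit, so the pot is $3$. Let $r$ be the number of holding players. If $r=0$, the immediate return to each player is $0$ and the game is replayed with stakes factor $1$. If $r\ge1$, the stakes factor for the replay is $r-1$ (factor $0$ means the game ends) and a player's immediate return is $(r-2)+3$ if the player holds and has the highest hand among holders, $(r-2)-3$ if the player holds but does not have the highest hand, and $r-2$ if the player drops. $\alpha(p_1^*,p_2^*,p_3^* )$ is the expected immediate return to player 1 (minus the joint immediate return of players 2-3), $\beta(p_1^*,p_2^*,p_3^* )$ the expected stakes factor; for a mixed joint strategy $\nu$ of players 2-3 (a probability measure on pairs $(p_2^*,p_3^* )$), $\alpha(p_1^*,\nu)$ and $\beta(p_1^*,\nu)$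 are the averages. Winning strategy for players 2-3: early exit costs a fee of $1$ times current stakes. Put $h_0=1$, $h_{n+1}=\sup_{p\in[0,1]}[\alpha(p,\nu)+\beta(p,\nu)h_n]$, the upper bound on player 1's return that players 2-3 force by repeating $\nu$ in the $n$-truncated game. The strategy $\nu$ is winning if $\inf_nh_n<0$, i.e. it forces a strictly negative return for player 1 and a strictly positive joint return for players 2-3. *)

theory Defs
  imports "HOL-Probability.Probability"
begin

definition players :: "nat set" where
  "players = {1, 2, 3}"

text \<open>Thresholds and hands are both functions of the player.\<close>

definition holders :: "(nat \<Rightarrow> real) \<Rightarrow> (nat \<Rightarrow> real) \<Rightarrow> nat set" where
  "holders t x = {i \<in> players. t i \<le> x i}"

definition stakes_factor :: "(nat \<Rightarrow> real) \<Rightarrow> (nat \<Rightarrow> real) \<Rightarrow> real" where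
  "stakes_factor t x =
     (let r = card (holders t x) in if r = 0 then 1 else real r - 1)"

text \<open>Tied highest hands all count as highest; ties have probability zero.\<close>

definition immediate_return :: "(nat \<Rightarrow> real) \<Rightarrow> (nat \<Rightarrow> real) \<Rightarrow> nat \<Rightarrow> real" where
  "immediate_return t x i =
     (let r = card (holders t x) in
      if r = 0 then 0
      else if i \<notin> holders t x then real r - 2
      else if \<forall>j \<in> holders t x. x j \<le> x i then (real r - 2) + 3
      else (real r - 2) - 3)"

definition hands :: "(nat \<Rightarrow> real) measure" where
  "hands = PiM players (\<lambda>_. uniform_measure lborel {0..1})"

definition thresholds :: "real \<Rightarrow> real \<Rightarrow> real \<Rightarrow> nat \<Rightarrow> real" where
  "thresholds p1 p2 p3 i = (if i = 1 then p1 else if i = 2 then p2 else p3)"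

definition alpha :: "real \<Rightarrow> real \<Rightarrow> real \<Rightarrow> real" where
  "alpha p1 p2 p3 = (\<integral>x. immediate_return (thresholds p1 p2 p3) x 1 \<partial>hands)"

definition beta :: "real \<Rightarrow> real \<Rightarrow> real \<Rightarrow> real" where
  "beta p1 p2 p3 = (\<integral>x. stakes_factor (thresholds p1 p2 p3) x \<partial>hands)"

definition mixed_strategy :: "(real \<times> real) measure \<Rightarrow> bool" where
  "mixed_strategy \<nu> \<longleftrightarrow>
     prob_space \<nu> \<and> sets \<nu> = sets borel \<and> (AE q in \<nu>. q \<in> {0..1} \<times> {0..1})"

definition alpha_mixed :: "real \<Rightarrow> (real \<times> real) measure \<Rightarrow> real" where
  "alpha_mixed p1 \<nu> = (\<integral>q. alpha p1 (fst q) (snd q) \<partial>\<nu>)"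

definition beta_mixed :: "real \<Rightarrow> (real \<times> real) measure \<Rightarrow> real" where
  "beta_mixed p1 \<nu> = (\<integral>q. beta p1 (fst q) (snd q) \<partial>\<nu>)"

text \<open>
  The mixture \<open>(1 - c) A + c B\<close> of two joint pure strategies, for \<open>0 \<le> c \<le> 1\<close>
  (outside this range \<open>bernoulli_pmf\<close> clamps \<open>c\<close>).
\<close>

definition mix :: "real \<Rightarrow> real \<times> real \<Rightarrow> real \<times> real \<Rightarrow> (real \<times> real) measure" where
  "mix c A B = distr (measure_pmf (bernoulli_pmf c)) borel (\<lambda>b. if b then B else A)"

text \<open>
  For a mixed strategy the supremum is over a bounded set, because the immediate
  returns and the stakes factors are bounded.
\<close>

primrec truncated_bound :: "(real \<times> real) measure \<Rightarrow> nat \<Rightarrow> real" where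
  "truncated_bound \<nu> 0 = 1"
| "truncated_bound \<nu> (Suc n) =
     (SUP p\<in>{0..1}. alpha_mixed p \<nu> + beta_mixed p \<nu> * truncated_bound \<nu> n)"

text \<open>
  The infimum is taken in the extended reals since the sequence need not be
  bounded below (average stakes factors may exceed 1).
\<close>

definition winning_strategy :: "(real \<times> real) measure \<Rightarrow> bool" where
  "winning_strategy \<nu> \<longleftrightarrow>
     mixed_strategy \<nu> \<and> (INF n. ereal (truncated_bound \<nu> n)) < 0"

end

theory Submission imports Defs begin

text \<open>
  Integrating over the three hands gives closed forms. With \<open>s = 1 / sqrt 2\<close>, the return of
  player 1 against equal thresholds \<open>q\<close> is \<open>2 * (p - q) * (1 - 2 * q\<^sup>2)\<close> for \<open>p \<le> q\<close> and
  \<open>2 * (p - q) * (1 - p * (p + q))\<close> for \<open>p \<ge> q\<close> (\<open>alpha_equal_thresholds\<close>).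
  For \<open>q = s - \<epsilon>\<close>, strategy \<open>A\<close>, this is negative of order \<open>\<epsilon>\<close> or worse when \<open>p\<close> stays away from
  \<open>s\<close>. The one weakness of \<open>A\<close> lies just above \<open>q\<close>: on an interval of length of order \<open>\<epsilon>\<close> player 1
  has a gain, which is then only of order \<open>\<epsilon>\<^sup>2\<close>.

  Strategy \<open>B\<close> repairs this weakness. Against \<open>(0, s + \<delta>)\<close> with small \<open>\<delta> > 0\<close>, player 1 loses
  a fixed amount for all \<open>p\<close> in a fixed neighbourhood of \<open>s\<close> (\<open>alpha_B_near\<close>). Playing \<open>B\<close> with
  probability \<open>C * \<epsilon>\<^sup>2\<close>, where \<open>C\<close> is large, thus outweighs the gain against \<open>A\<close> near \<open>s\<close>; away
  from \<open>s\<close>, whatever \<open>B\<close> concedes is of order \<open>C * \<epsilon>\<^sup>2\<close> and is dominated by the loss of order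
  \<open>\<epsilon>\<close> against \<open>A\<close> once \<open>\<epsilon>\<close> is small. The explicit choice \<open>\<delta> = 1 / 10\<close>, \<open>C \<ge> 200\<close>,
  \<open>(2 * C + 1) * \<epsilon> \<le> 1 / 100\<close> yields the uniform bound \<open>- \<epsilon>\<^sup>2\<close> on the return
  (\<open>alpha_mixture_le\<close>).

  The stakes factor is close to \<open>2 - sqrt 2\<close> or smaller against \<open>A\<close>, and \<open>B\<close> has small weight
  (\<open>beta_mixture_le\<close>). A uniformly negative return with stakes that do not grow on average forces
  the truncated bounds below zero (\<open>winning_strategyI\<close>).
\<close>

section \<open>The distribution of the hands\<close>

abbreviation hand :: "real measure" where
  "hand \<equiv> uniform_measure lborel {0..1}"

lemma prob_space_hand: "prob_space hand"
  by (rule prob_space_uniform_measure) auto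

lemma sets_hand [measurable_cong]: "sets hand = sets borel"
  by simp

lemma prob_space_hands: "prob_space hands"
  unfolding hands_def by (intro prob_space_PiM prob_space_hand)

lemma measurable_hands_component:
  "i \<in> {1, 2, 3} \<Longrightarrow> (\<lambda>x. x i) \<in> borel_measurable hands"
  unfolding hands_def players_def by measurable

text \<open>
  Fubini, with the hand of player 1 outermost: once that hand \<open>a\<close> is known, whether player 1
  beats player 2 and whether player 1 beats player 3 are independent events, so that the two
  inner integrals factor.
\<close>

lemma integral_hands:
  fixes g :: "real \<Rightarrow> real \<Rightarrow> real \<Rightarrow> real"
  assumes meas [measurable]: "(\<lambda>(a, b, c). g a b c) \<in> borel_measurable (borel \<Otimes>\<^sub>M borel \<Otimes>\<^sub>M borel)"
    and bound: "\<And>a b c. \<bar>g a b c\<bar> \<le> B"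
  shows "(\<integral>x. g (x 1) (x 2) (x 3) \<partial>hands)
    = (\<integral>a. \<integral>b. \<integral>c. g a b c \<partial>hand \<partial>hand \<partial>hand)"
proof -
  interpret U: prob_space hand by (rule prob_space_hand)
  interpret P: product_prob_space "\<lambda>_::nat. hand" UNIV
    by unfold_locales
  interpret P1: prob_space "PiM {1, 2} (\<lambda>_::nat. hand)"
    by (intro prob_space_PiM prob_space_hand)
  have p3: "players = insert 3 {1, 2}" unfolding players_def by auto
  have p2: "{1, 2} = insert 2 {1::nat}" by auto
  have gm: "(\<lambda>x. g (f1 x) (f2 x) (f3 x)) \<in> borel_measurable M"
    if [measurable]: "f1 \<in> borel_measurable M" "f2 \<in> borel_measurable M" "f3 \<in> borel_measurable M"
    for f1 f2 f3 :: "'b \<Rightarrow> real" and M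
    using measurable_compose[OF _ meas, of "\<lambda>x. (f1 x, f2 x, f3 x)"] by simp
  have "(\<lambda>x. g (x 1) (x 2) (x 3)) \<in> borel_measurable hands"
    by (intro gm measurable_hands_component) auto
  note [measurable] = this
  have int3: "integrable (PiM (insert 3 {1, 2}) (\<lambda>_::nat. hand)) (\<lambda>x. g (x 1) (x 2) (x 3))"
    unfolding p3[symmetric] hands_def[symmetric]
    by (intro finite_measure.integrable_const_bound[where B=B] AE_I2)
       (use bound prob_space_hands in \<open>auto simp: prob_space_def simp del: One_nat_def\<close>)
  have gm_int: "(\<lambda>x. \<integral>c. g (f1 x) (f2 x) c \<partial>hand) \<in> borel_measurable M"
    if "f1 \<in> borel_measurable M" "f2 \<in> borel_measurable M"
    for f1 f2 :: "'b \<Rightarrow> real" and M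
    using that by (intro U.borel_measurable_lebesgue_integral) (simp add: split_beta' gm)
  have "\<bar>\<integral>c. g a b c \<partial>hand\<bar> \<le> B" for a b
  proof -
    have "\<bar>\<integral>c. g a b c \<partial>hand\<bar> \<le> (\<integral>c. \<bar>g a b c\<bar> \<partial>hand)"
      by (rule integral_abs_bound)
    also have "\<dots> \<le> B"
      by (rule U.integral_le_const)
         (use bound in \<open>auto intro!: U.integrable_const_bound[where B=B] AE_I2\<close>)
    finally show ?thesis .
  qed
  then have int2: "integrable (PiM (insert 2 {1}) (\<lambda>_::nat. hand)) (\<lambda>x. \<integral>c. g (x 1) (x 2) c \<partial>hand)"
    unfolding p2[symmetric]
    by (intro P1.integrable_const_bound[where B=B] AE_I2 gm_int) auto
  have "(\<integral>x. g (x 1) (x 2) (x 3) \<partial>hands)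
     = (\<integral>x. \<integral>c. g (x 1) (x 2) c \<partial>hand \<partial>PiM {1, 2} (\<lambda>_::nat. hand))"
    unfolding hands_def p3 by (subst P.product_integral_insert[OF _ _ int3]) auto
  also have "\<dots> = (\<integral>x. \<integral>b. \<integral>c. g (x 1) b c \<partial>hand \<partial>hand \<partial>PiM {1} (\<lambda>_::nat. hand))"
    unfolding p2 by (subst P.product_integral_insert[OF _ _ int2]) auto
  also have "\<dots> = (\<integral>a. \<integral>b. \<integral>c. g a b c \<partial>hand \<partial>hand \<partial>hand)"
    by (rule P.product_integral_singleton, rule U.borel_measurable_lebesgue_integral)
       (simp add: split_beta' gm_int)
  finally show ?thesis .
qed

lemma measure_hand_atLeast: "0 \<le> c \<Longrightarrow> c \<le> 1 \<Longrightarrow> measure hand {c..} = 1 - c"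
proof -
  assume "0 \<le> c" "c \<le> 1"
  then have "{0..1} \<inter> {c..} = {c..1}" by auto
  then show ?thesis using \<open>c \<le> 1\<close> by (subst measure_uniform_measure) auto
qed

lemma measure_hand_lessThan: "0 \<le> c \<Longrightarrow> c \<le> 1 \<Longrightarrow> measure hand {..<c} = c"
proof -
  assume "0 \<le> c" "c \<le> 1"
  then have "{0..1} \<inter> {..<c} = {0..<c}" by auto
  then show ?thesis using \<open>0 \<le> c\<close> by (subst measure_uniform_measure) auto
qed

text \<open>
  An opponent with threshold \<open>c\<close> fails to beat a holder with hand \<open>x\<close> by dropping or by having
  a hand that is no better. The two events are nested, so the larger of their probabilities
  counts; this is the origin of the factors \<open>max b x\<close> and \<open>max c x\<close> below.
\<close>

lemma measure_hand_not_beaten: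
  assumes "x \<in> {0..1}" "c \<in> {0..1}"
  shows "measure hand ({..<c} \<union> {..x}) = max c x"
proof -
  have "{0..1} \<inter> ({..<c} \<union> {..x}) = (if c \<le> x then {0..x} else {0..<c})"
    using assms by auto
  then show ?thesis using assms by (subst measure_uniform_measure) auto
qed

lemma integral_hand:
  assumes [measurable]: "f \<in> borel_measurable borel"
  shows "integral\<^sup>L hand (f :: real \<Rightarrow> real) = (LBINT x:{0..1}. f x)"
proof -
  have "hand = density lborel (\<lambda>x. ennreal (indicator {0..1} x))"
    unfolding uniform_measure_def by (rule density_cong) (auto split: split_indicator)
  then have "integral\<^sup>L hand f = integral\<^sup>L (density lborel (\<lambda>x. ennreal (indicator {0..1} x))) f"
    by (simp only:)
  also have "\<dots> = (LBINT x:{0..1}. f x)"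
    unfolding set_lebesgue_integral_def
    by (rule integral_density) auto
  finally show ?thesis .
qed

section \<open>Expected return and expected stakes factor\<close>

text \<open>
  The immediate return of player 1 as a polynomial in indicators of single hands, which makes
  every integral a product of probabilities. If player 1 drops, the return is \<open>-1\<close> when
  exactly one opponent holds and \<open>0\<close> otherwise. If player 1 holds along with \<open>k\<close> opponents, it
  is \<open>k - 4\<close>, raised by \<open>6\<close> when neither opponent beats player 1.
\<close>

definition return_of_hands :: "real \<Rightarrow> real \<Rightarrow> real \<Rightarrow> real \<Rightarrow> real \<Rightarrow> real \<Rightarrow> real" where
  "return_of_hands p b c x y z =
     indicator {..<p} x *
       (2 * indicator {b..} y * indicator {c..} z - indicator {b..} y - indicator {c..} z)
   + indicator {p..} x *
       (indicator {b..} y + indicator {c..} z - 4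
        + 6 * indicator ({..<b} \<union> {..x}) y * indicator ({..<c} \<union> {..x}) z)"

lemma holders_thresholds:
  "holders (thresholds p b c) x
    = (if p \<le> x 1 then {1} else {}) \<union> (if b \<le> x 2 then {2} else {}) \<union> (if c \<le> x 3 then {3} else {})"
  unfolding holders_def players_def thresholds_def by auto

lemma immediate_return_eq:
  "immediate_return (thresholds p b c) x 1 = return_of_hands p b c (x 1) (x 2) (x 3)"
  unfolding immediate_return_def holders_thresholds return_of_hands_def Let_def
  by (auto simp: indicator_def)

lemma stakes_factor_eq:
  "stakes_factor (thresholds p b c) x
    = indicator {p..} (x 1) + indicator {b..} (x 2) + indicator {c..} (x 3) - 1
      + 2 * indicator {..<p} (x 1) * indicator {..<b} (x 2) * indicator {..<c} (x 3)"
  unfolding stakes_factor_def holders_thresholds Let_def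
  by (auto simp: indicator_def)

lemma return_of_hands_bounded: "\<bar>return_of_hands p b c x y z\<bar> \<le> 4"
  unfolding return_of_hands_def by (auto simp: indicator_def)

lemma measurable_return_of_hands [measurable]:
  assumes [measurable]: "f \<in> borel_measurable M" "g \<in> borel_measurable M" "h \<in> borel_measurable M"
    "u \<in> borel_measurable M" "v \<in> borel_measurable M"
  shows "(\<lambda>w. return_of_hands p (u w) (v w) (f w) (g w) (h w)) \<in> borel_measurable M"
  unfolding return_of_hands_def indicator_def by simp

lemma integrable_hand_indicator [simp]: "S \<in> sets borel \<Longrightarrow> integrable hand (indicator S :: real \<Rightarrow> real)"
  using prob_space_hand
  by (intro finite_measure.integrable_const_bound[where B=1] AE_I2)
     (auto simp: prob_space_def indicator_def)

text \<open>
  The first term comes from dropping. The second counts every hold of player 1 as lost; the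
  integral is the probability of holding and winning, which corrects this by \<open>6\<close> each time.
\<close>

lemma alpha_eq:
  assumes p: "p \<in> {0..1}" and b: "b \<in> {0..1}" and c: "c \<in> {0..1}"
  shows "alpha p b c = - p * (b + c - 2 * b * c) - (1 - p) * (2 + b + c)
           + 6 * integral {p..1} (\<lambda>x. max b x * max c x)"
proof -
  interpret U: prob_space hand by (rule prob_space_hand)
  have mb: "measure hand {b..} = 1 - b" and mc: "measure hand {c..} = 1 - c"
    and mp: "measure hand {p..} = 1 - p" and mp': "measure hand {..<p} = p"
    using assms by (simp_all add: measure_hand_atLeast measure_hand_lessThan del: measure_uniform_measure)
  have inner: "(\<integral>y. \<integral>z. return_of_hands p b c x y z \<partial>hand \<partial>hand)
      = - (b + c - 2 * b * c) * indicator {..<p} x - (2 + b + c) * indicator {p..} x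
        + 6 * (indicator {p..} x * (max b x * max c x))" if x: "x \<in> {0..1}" for x
  proof -
    have "(\<integral>z. return_of_hands p b c x y z \<partial>hand)
      = indicator {..<p} x *
       (2 * indicator {b..} y * (1 - c) - indicator {b..} y - (1 - c))
      + indicator {p..} x *
       (indicator {b..} y + (1 - c) - 4
        + 6 * indicator ({..<b} \<union> {..x}) y * max c x)" for y
      unfolding return_of_hands_def
      using measure_hand_not_beaten[OF x c] mc by (simp add: U.prob_space[simplified])
    then show ?thesis
      using measure_hand_not_beaten[OF x b] mb
      by (simp add: U.prob_space[simplified]) (simp add: algebra_simps indicator_def)
  qed
  have cont: "continuous_on {p..1} (\<lambda>x. max b x * max c x)"
    by (intro continuous_intros)
  have "(\<integral>x. indicator {p..} x * (max b x * max c x) \<partial>hand)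
      = (LBINT x:{p..1}. max b x * max c x)"
    using p by (subst integral_hand)
      (auto simp: set_lebesgue_integral_def indicator_def intro!: Bochner_Integration.integral_cong)
  also have "\<dots> = integral {p..1} (\<lambda>x. max b x * max c x)"
    by (intro set_borel_integral_eq_integral borel_integrable_atLeastAtMost' cont)
  finally have win: "(\<integral>x. indicator {p..} x * (max b x * max c x) \<partial>hand)
      = integral {p..1} (\<lambda>x. max b x * max c x)" .
  have AE: "AE x in hand. x \<in> {0..1}"
    by (rule AE_uniform_measureI) auto
  have "AE x in hand. norm (indicator {p..} x * (max b x * max c x)) \<le> 1"
    using AE by eventually_elim
      (use b c in \<open>auto simp: indicator_def abs_mult max_def intro!: mult_le_one\<close>)
  then have int: "integrable hand (\<lambda>x. indicator {p..} x * (max b x * max c x))"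
    by (rule U.integrable_const_bound) measurable
  have "alpha p b c = (\<integral>x. \<integral>y. \<integral>z. return_of_hands p b c x y z \<partial>hand \<partial>hand \<partial>hand)"
    unfolding alpha_def immediate_return_eq
    by (rule integral_hands[where B=4]) (simp_all add: return_of_hands_bounded split_beta')
  also have "\<dots> = (\<integral>x. - (b + c - 2 * b * c) * indicator {..<p} x - (2 + b + c) * indicator {p..} x
        + 6 * (indicator {p..} x * (max b x * max c x)) \<partial>hand)"
  proof (rule integral_cong_AE)
    show "(\<lambda>x. \<integral>y. \<integral>z. return_of_hands p b c x y z \<partial>hand \<partial>hand) \<in> borel_measurable hand"
      by (intro U.borel_measurable_lebesgue_integral) (simp add: split_beta' U.borel_measurable_lebesgue_integral)
    show "AE x in hand. (\<integral>y. \<integral>z. return_of_hands p b c x y z \<partial>hand \<partial>hand)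
      = - (b + c - 2 * b * c) * indicator {..<p} x - (2 + b + c) * indicator {p..} x
        + 6 * (indicator {p..} x * (max b x * max c x))"
      using AE by eventually_elim (rule inner)
  qed measurable
  also have "\<dots> = - p * (b + c - 2 * b * c) - (1 - p) * (2 + b + c)
           + 6 * integral {p..1} (\<lambda>x. max b x * max c x)"
    using int by (simp add: mp mp' win) (simp add: algebra_simps)
  finally show ?thesis .
qed

lemma beta_eq:
  assumes p: "p \<in> {0..1}" and b: "b \<in> {0..1}" and c: "c \<in> {0..1}"
  shows "beta p b c = 2 - p - b - c + 2 * p * b * c"
proof -
  interpret U: prob_space hand by (rule prob_space_hand)
  have m: "measure hand {b..} = 1 - b" "measure hand {c..} = 1 - c"
    "measure hand {p..} = 1 - p" "measure hand {..<p} = p" "measure hand {..<b} = b" "measure hand {..<c} = c"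
    using assms by (simp_all add: measure_hand_atLeast measure_hand_lessThan del: measure_uniform_measure)
  have "beta p b c = (\<integral>x. \<integral>y. \<integral>z.
      indicator {p..} x + indicator {b..} y + indicator {c..} z - 1
      + 2 * indicator {..<p} x * indicator {..<b} y * indicator {..<c} z \<partial>hand \<partial>hand \<partial>hand)"
    unfolding beta_def stakes_factor_eq
    by (rule integral_hands[where B=4]) (measurable, auto simp: indicator_def)
  also have "\<dots> = 2 - p - b - c + 2 * p * b * c"
    by (simp add: m U.prob_space[simplified])
  finally show ?thesis .
qed

lemma integral_mix:
  assumes "0 \<le> w" "w \<le> 1" and [measurable]: "f \<in> borel_measurable borel"
  shows "(\<integral>q. f q \<partial>mix w A B) = (1 - w) * (f A :: real) + w * f B"
  unfolding mix_def using assms(1,2) by (subst integral_distr) auto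

text \<open>
  \<open>mix w A B\<close> is a measure on the Borel sets, so the rule \<open>integral_mix\<close> applies to the averages of
  \<open>alpha\<close> and \<open>beta\<close> only once these are known to be Borel functions of the opponents' thresholds.
\<close>

lemma measurable_alpha: "(\<lambda>q. alpha p (fst q) (snd q)) \<in> borel_measurable borel"
proof -
  interpret prob_space hands by (rule prob_space_hands)
  have [measurable]: "(\<lambda>x. x i) \<in> borel_measurable hands" if "i \<in> {1, 2, 3}" for i
    using measurable_hands_component that by blast
  show ?thesis
    unfolding alpha_def immediate_return_eq by (simp add: borel_prod[symmetric] split_beta' del: One_nat_def)
qed

lemma measurable_beta: "(\<lambda>q. beta p (fst q) (snd q)) \<in> borel_measurable borel"
proof -
  interpret prob_space hands by (rule prob_space_hands)
  have [measurable]: "(\<lambda>x. x i) \<in> borel_measurable hands" if "i \<in> {1, 2, 3}" for i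
    using measurable_hands_component that by blast
  show ?thesis
    unfolding beta_def stakes_factor_eq indicator_def by (simp add: borel_prod[symmetric] split_beta' del: One_nat_def)
qed

lemma mixed_strategy_mix:
  assumes "A \<in> {0..1} \<times> {0..1}" "B \<in> {0..1} \<times> {0..1}"
  shows "mixed_strategy (mix w A B)"
proof -
  have "AE q in mix w A B. q \<in> {0..1} \<times> {0..1}"
    unfolding mix_def using assms
    by (subst AE_distr_iff) (auto simp: borel_prod[symmetric] space_pair_measure)
  then show ?thesis
    unfolding mixed_strategy_def mix_def
    by (auto intro!: prob_space.prob_space_distr prob_space_measure_pmf)
qed

section \<open>A criterion for winning strategies\<close>

text \<open>
  As long as the bounds \<open>h n\<close> stay nonnegative, \<open>\<beta> \<le> 1\<close> gives \<open>h (n + 1) \<le> h n - a\<close>. Such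
  a decrease by a fixed amount cannot go on forever, so some \<open>h n\<close> is negative.
\<close>

lemma winning_strategyI:
  assumes "mixed_strategy \<nu>" and "a > 0"
    and alpha: "\<And>p. p \<in> {0..1} \<Longrightarrow> alpha_mixed p \<nu> \<le> - a"
    and beta: "\<And>p. p \<in> {0..1} \<Longrightarrow> beta_mixed p \<nu> \<le> 1"
  shows "winning_strategy \<nu>"
proof -
  have "\<exists>n. truncated_bound \<nu> n < 0"
  proof (rule ccontr)
    assume "\<not> ?thesis"
    then have nonneg: "0 \<le> truncated_bound \<nu> n" for n by (simp add: not_less)
    have le: "truncated_bound \<nu> n \<le> 1 - real n * a" for n
    proof (induction n)
      case (Suc n)
      have "truncated_bound \<nu> (Suc n) \<le> - a + truncated_bound \<nu> n"
        unfolding truncated_bound.simps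
      proof (rule cSUP_least)
        fix p :: real assume p: "p \<in> {0..1}"
        show "alpha_mixed p \<nu> + beta_mixed p \<nu> * truncated_bound \<nu> n \<le> - a + truncated_bound \<nu> n"
          using alpha[OF p] mult_right_mono[OF beta[OF p] nonneg[of n]] by simp
      qed simp
      with Suc show ?case by (simp add: algebra_simps)
    qed simp
    obtain n where "1 < real n * a" using reals_Archimedean3[OF \<open>a > 0\<close>] by blast
    with le[of n] nonneg[of n] show False by simp
  qed
  then show ?thesis
    using assms(1) unfolding winning_strategy_def by (auto simp: INF_less_iff)
qed

section \<open>The return against the two joint pure strategies\<close>

lemma has_integral_square_to_1:
  fixes r :: real
  assumes "r \<le> 1"
  shows "((\<lambda>x. x\<^sup>2) has_integral (1 - r ^ 3) / 3) {r..1}"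
proof -
  have "((\<lambda>x::real. x\<^sup>2) has_integral 1 ^ 3 / 3 - r ^ 3 / 3) {r..1}"
    by (rule fundamental_theorem_of_calculus[OF assms])
       (auto intro!: derivative_eq_intros simp flip: has_real_derivative_iff_has_vector_derivative)
  then show ?thesis by (simp add: diff_divide_distrib)
qed

lemma integral_max_square:
  fixes p q :: real
  assumes "p \<le> 1" "q \<le> 1"
  shows "integral {p..1} (\<lambda>x. max q x * max q x)
    = (if p \<le> q then (q - p) * q\<^sup>2 + (1 - q ^ 3) / 3 else (1 - p ^ 3) / 3)"
proof -
  have above: "((\<lambda>x. max q x * max q x) has_integral (1 - r ^ 3) / 3) {r..1}" if "q \<le> r" "r \<le> 1" for r
    by (rule has_integral_eq[OF _ has_integral_square_to_1[OF that(2)]])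
       (use that in \<open>auto simp: power2_eq_square max_def\<close>)
  show ?thesis
  proof (cases "p \<le> q")
    case True
    have "((\<lambda>x. q\<^sup>2) has_integral (q - p) * q\<^sup>2) {p..q}"
      using has_integral_const_real[of "q\<^sup>2" p q] True by simp
    then have "((\<lambda>x. max q x * max q x) has_integral (q - p) * q\<^sup>2) {p..q}"
      by (rule has_integral_eq[rotated]) (auto simp: power2_eq_square max_def)
    from has_integral_combine[OF True \<open>q \<le> 1\<close> this above[of q]] True assms show ?thesis
      by (simp add: integral_unique)
  qed (use above[of p] assms in \<open>auto simp: integral_unique\<close>)
qed

lemma integral_max_linear:
  fixes p u :: real
  assumes "0 \<le> p" "p \<le> 1" "u \<le> 1"
  shows "integral {p..1} (\<lambda>x. max 0 x * max u x)
    = (if p \<le> u then u * (u\<^sup>2 - p\<^sup>2) / 2 + (1 - u ^ 3) / 3 else (1 - p ^ 3) / 3)"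
proof -
  have above: "((\<lambda>x. max 0 x * max u x) has_integral (1 - r ^ 3) / 3) {r..1}"
    if "0 \<le> r" "u \<le> r" "r \<le> 1" for r
    by (rule has_integral_eq[OF _ has_integral_square_to_1[OF that(3)]])
       (use that in \<open>auto simp: power2_eq_square max_def\<close>)
  show ?thesis
  proof (cases "p \<le> u")
    case True
    have "((\<lambda>x. x * u) has_integral u * u\<^sup>2 / 2 - u * p\<^sup>2 / 2) {p..u}"
      by (rule fundamental_theorem_of_calculus[OF True])
         (auto intro!: derivative_eq_intros simp flip: has_real_derivative_iff_has_vector_derivative)
    then have "((\<lambda>x. max 0 x * max u x) has_integral u * u\<^sup>2 / 2 - u * p\<^sup>2 / 2) {p..u}"
      by (rule has_integral_eq[rotated]) (use assms in \<open>auto simp: max_def\<close>)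
    from has_integral_combine[OF True \<open>u \<le> 1\<close> this above[of u]] True assms show ?thesis
      by (simp add: integral_unique right_diff_distrib diff_divide_distrib)
  qed (use above[of p] assms in \<open>auto simp: integral_unique\<close>)
qed

text \<open>
  The factor \<open>1 - 2 * q\<^sup>2\<close> explains the critical threshold \<open>1 / sqrt 2\<close>: there player 1 breaks even
  with every threshold \<open>p \<le> q\<close>. For \<open>q\<close> slightly below, small \<open>p\<close> lose, but \<open>p\<close> slightly
  above \<open>q\<close> wins a little.
\<close>

lemma alpha_equal_thresholds:
  assumes "p \<in> {0..1}" "q \<in> {0..1}"
  shows "alpha p q q = 2 * (p - q) * (1 - (if p \<le> q then 2 * q\<^sup>2 else p * (p + q)))"
  using assms
  by (simp add: alpha_eq integral_max_square) (simp add: field_simps power2_eq_square power3_eq_cube)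

lemma alpha_zero_threshold:
  assumes "p \<in> {0..1}" "u \<in> {0..1}"
  shows "alpha p 0 u = 2 * p - u + (if p \<le> u then u ^ 3 - 3 * u * p\<^sup>2 else - 2 * p ^ 3)"
  using assms
  by (simp add: alpha_eq integral_max_linear) (simp add: field_simps power2_eq_square power3_eq_cube)

lemma alpha_zero_threshold_le:
  assumes "p \<in> {0..1}" "u \<in> {0..1}"
  shows "alpha p 0 u \<le> 2"
proof -
  have "u ^ 3 \<le> u" using assms power_decreasing[of 1 3 u] by simp
  moreover have "0 \<le> 3 * u * p\<^sup>2" "0 \<le> p ^ 3" using assms by auto
  moreover have "p \<le> 1" "0 \<le> u" using assms by auto
  ultimately show ?thesis
    unfolding alpha_zero_threshold[OF assms] by (simp only: split: if_split) (intro conjI impI; linarith)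
qed

section \<open>The mixture near the critical threshold\<close>

lemma inverse_sqrt_2_bounds: "7 / 10 < 1 / sqrt 2" "1 / sqrt 2 < 71 / 100"
proof -
  have "(7 / 10)\<^sup>2 < (1 / sqrt 2)\<^sup>2" "(1 / sqrt 2)\<^sup>2 < (71 / 100)\<^sup>2"
    by (simp_all add: power_divide)
  then show "7 / 10 < 1 / sqrt 2" "1 / sqrt 2 < 71 / 100"
    by (auto dest: power_less_imp_less_base)
qed

text \<open>
  In what follows \<open>s\<close> is \<open>1 / sqrt 2\<close>, known only through \<open>2 * s\<^sup>2 = 1\<close> and crude decimal
  bounds, so that all the estimates are polynomial.
\<close>

context
  fixes s :: real
  assumes s2: "2 * s\<^sup>2 = 1" and s: "7 / 10 < s" "s < 71 / 100"
begin

text \<open>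
  At \<open>p = s\<close> and with \<open>2 * s\<^sup>2 = 1\<close>, the return against \<open>(0, u)\<close> factors as
  \<open>(u - s) * (u\<^sup>2 + s * u - 2)\<close>, which vanishes at \<open>u = s\<close> and is negative for \<open>u\<close> slightly larger.
  For \<open>u = s + 1 / 10\<close> it is below \<open>- 7 / 100\<close>; its slope in \<open>p\<close> is at most \<open>2\<close> in absolute
  value, which leaves a definite loss within \<open>1 / 50\<close> of \<open>s\<close>.
\<close>

lemma alpha_B_near:
  assumes "\<bar>p - s\<bar> \<le> 1 / 50"
  shows "alpha p 0 (s + 1 / 10) \<le> - 1 / 50"
proof -
  let ?u = "s + 1 / 10"
  have p: "0 \<le> p" "p \<le> 1" "p \<le> ?u" using assms s by linarith+
  have "alpha p 0 ?u = (?u - s) * (?u\<^sup>2 + s * ?u - 2) + (p - s) * (2 - 3 * ?u * (p + s)) + ?u * (1 - 2 * s\<^sup>2)"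
    using p s by (subst alpha_zero_threshold) (auto simp: field_simps power2_eq_square power3_eq_cube)
  also have "\<dots> = (1 / 10) * (?u\<^sup>2 + s * ?u - 2) + (p - s) * (2 - 3 * ?u * (p + s))"
    by (simp add: s2)
  also have "?u\<^sup>2 + s * ?u - 2 \<le> - 7 / 10"
    using s2 s by (simp add: power2_eq_square algebra_simps)
  also have "(p - s) * (2 - 3 * ?u * (p + s)) \<le> (1 / 50) * 2"
  proof -
    have "\<bar>2 - 3 * ?u * (p + s)\<bar> \<le> 2"
    proof -
      have "?u * (p + s) \<le> (81 / 100) * (144 / 100)"
        using assms s by (intro mult_mono) linarith+
      moreover have "0 \<le> ?u * (p + s)" using p s by auto
      ultimately show ?thesis by linarith
    qed
    with assms have "\<bar>p - s\<bar> * \<bar>2 - 3 * ?u * (p + s)\<bar> \<le> (1 / 50) * 2"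
      by (intro mult_mono) auto
    then show ?thesis unfolding abs_mult[symmetric] by linarith
  qed
  finally show ?thesis by simp
qed

lemma alpha_A_left:
  assumes "0 < \<epsilon>" "\<epsilon> \<le> 1 / 200" "0 \<le> p" "p \<le> s - \<epsilon>"
  shows "alpha p (s - \<epsilon>) (s - \<epsilon>) \<le> - 2 * \<epsilon> * (s - \<epsilon> - p)"
proof -
  have "alpha p (s - \<epsilon>) (s - \<epsilon>) = - 2 * (s - \<epsilon> - p) * (\<epsilon> * (4 * s - 2 * \<epsilon>))"
    using assms s s2
    by (subst alpha_equal_thresholds) (auto simp: power2_eq_square algebra_simps)
  moreover have "(s - \<epsilon> - p) * (\<epsilon> * 1) \<le> (s - \<epsilon> - p) * (\<epsilon> * (4 * s - 2 * \<epsilon>))"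
    using assms s by (intro mult_left_mono) auto
  ultimately show ?thesis by (simp add: algebra_simps)
qed

text \<open>
  The gain of a player 1 who holds slightly less often than the opponents: in \<open>d\<close> it is bounded
  by a parabola that is positive only for \<open>d < 3 / 2 * \<epsilon>\<close> and has maximum \<open>9 / 4 * \<epsilon>\<^sup>2\<close>.
\<close>

lemma alpha_A_right:
  assumes "0 < \<epsilon>" "\<epsilon> \<le> 1 / 200" "s - \<epsilon> \<le> p" "p \<le> 1"
  defines "d \<equiv> p - (s - \<epsilon>)"
  shows "alpha p (s - \<epsilon>) (s - \<epsilon>) \<le> 2 * d * (3 * \<epsilon> - 2 * d)"
proof -
  have "alpha p (s - \<epsilon>) (s - \<epsilon>) = 2 * d * (1 - p * (p + (s - \<epsilon>)))"
    using assms s unfolding d_def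
    by (subst alpha_equal_thresholds) (auto simp: power2_eq_square)
  also have "1 - p * (p + (s - \<epsilon>)) = \<epsilon> * (4 * s) - 2 * \<epsilon>\<^sup>2 - 3 * (s - \<epsilon>) * d - d\<^sup>2"
    using s2 unfolding d_def by (simp add: power2_eq_square algebra_simps)
  also have "2 * d * \<dots> \<le> 2 * d * (3 * \<epsilon> - 2 * d)"
  proof (rule mult_left_mono)
    have "\<epsilon> * (4 * s) \<le> \<epsilon> * 3" using assms s by (intro mult_left_mono) auto
    moreover have "2 * d \<le> 3 * (s - \<epsilon>) * d"
      using assms s by (intro mult_right_mono) auto
    moreover have "0 \<le> \<epsilon>\<^sup>2" "0 \<le> d\<^sup>2" by auto
    ultimately show "\<epsilon> * (4 * s) - 2 * \<epsilon>\<^sup>2 - 3 * (s - \<epsilon>) * d - d\<^sup>2 \<le> 3 * \<epsilon> - 2 * d"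
      by linarith
  qed (use assms in simp)
  finally show ?thesis .
qed

text \<open>
  Within \<open>1 / 50\<close> of \<open>s\<close>, strategy \<open>A\<close> concedes at most \<open>3 * \<epsilon>\<^sup>2\<close>, while the admixture of \<open>B\<close>
  takes at least \<open>C * \<epsilon>\<^sup>2 / 50\<close>, which is \<open>4 * \<epsilon>\<^sup>2\<close> for \<open>C = 200\<close>. Farther away \<open>B\<close> may concede up
  to \<open>2 * C * \<epsilon>\<^sup>2\<close>, but player 1 loses at least a multiple of \<open>\<epsilon>\<close> against \<open>A\<close>, and this is the larger
  quantity once \<open>C * \<epsilon>\<close> is small.
\<close>

lemma alpha_mixture_le:
  assumes C: "C \<ge> 200" and \<epsilon>: "0 < \<epsilon>" "(2 * C + 1) * \<epsilon> \<le> 1 / 100" and p: "p \<in> {0..1}"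
  shows "(1 - C * \<epsilon>\<^sup>2) * alpha p (s - \<epsilon>) (s - \<epsilon>) + C * \<epsilon>\<^sup>2 * alpha p 0 (s + 1 / 10) \<le> - \<epsilon>\<^sup>2"
proof -
  define w where "w = C * \<epsilon>\<^sup>2"
  let ?A = "alpha p (s - \<epsilon>) (s - \<epsilon>)" and ?B = "alpha p 0 (s + 1 / 10)"
  have "401 * \<epsilon> \<le> (2 * C + 1) * \<epsilon>"
    using C \<epsilon> by (intro mult_right_mono) auto
  with \<epsilon> have \<epsilon>s: "\<epsilon> \<le> 1 / 40100" by linarith
  have w2: "2 * w + \<epsilon>\<^sup>2 \<le> \<epsilon> / 100"
    using mult_right_mono[OF \<epsilon>(2), of \<epsilon>] \<epsilon>(1) unfolding w_def
    by (simp add: algebra_simps power2_eq_square)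
  have w: "0 \<le> w" "w \<le> 1 / 2"
    using C by (simp add: w_def) (use w2 \<epsilon>s zero_le_power2[of \<epsilon>] in linarith)
  have far: "(1 - w) * ?A + w * ?B \<le> - \<epsilon>\<^sup>2" if "?A \<le> - (\<epsilon> / 50)"
  proof -
    have "?B \<le> 2" using p s by (intro alpha_zero_threshold_le) auto
    then have "w * ?B \<le> w * 2" using w by (intro mult_left_mono) auto
    moreover have "(1 - w) * ?A \<le> (1 - w) * - (\<epsilon> / 50)"
      using that w by (intro mult_left_mono) auto
    moreover have "(1 / 2) * (\<epsilon> / 50) \<le> (1 - w) * (\<epsilon> / 50)"
      using w \<epsilon> by (intro mult_right_mono) auto
    ultimately show ?thesis using w2 by linarith
  qed
  have near: "(1 - w) * ?A + w * ?B \<le> - \<epsilon>\<^sup>2" if "?A \<le> 3 * \<epsilon>\<^sup>2" "\<bar>p - s\<bar> \<le> 1 / 50"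
  proof -
    have "w * ?B \<le> w * (- 1 / 50)"
      using alpha_B_near[OF that(2)] w by (intro mult_left_mono) auto
    moreover have "(1 - w) * ?A \<le> 1 * (3 * \<epsilon>\<^sup>2)"
      using that(1) w by (intro order.trans[OF mult_left_mono mult_right_mono]) auto
    moreover have "200 * \<epsilon>\<^sup>2 \<le> w" unfolding w_def using C by (intro mult_right_mono) auto
    ultimately show ?thesis by linarith
  qed
  show ?thesis
    unfolding w_def[symmetric]
  proof (cases "p \<le> s - \<epsilon>")
    case True
    have A: "?A \<le> - 2 * \<epsilon> * (s - \<epsilon> - p)"
      using alpha_A_left[of \<epsilon> p] \<epsilon> \<epsilon>s p True by auto
    show "(1 - w) * ?A + w * ?B \<le> - \<epsilon>\<^sup>2"
    proof (cases "p \<le> s - 1 / 50")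
      case far_left: True
      have "2 * \<epsilon> * (1 / 100) \<le> 2 * \<epsilon> * (s - \<epsilon> - p)"
        using \<epsilon> \<epsilon>s far_left by (intro mult_left_mono) auto
      with A show ?thesis by (intro far) linarith
    next
      case False
      have "0 \<le> 2 * \<epsilon> * (s - \<epsilon> - p)" using \<epsilon> True by auto
      with A have "?A \<le> 3 * \<epsilon>\<^sup>2" using zero_le_power2[of \<epsilon>] by linarith
      moreover have "\<bar>p - s\<bar> \<le> 1 / 50" using False True \<epsilon> by linarith
      ultimately show ?thesis by (rule near)
    qed
  next
    case False
    define d where "d = p - (s - \<epsilon>)"
    have d: "0 < d" using False by (simp add: d_def)
    have A: "?A \<le> 2 * d * (3 * \<epsilon> - 2 * d)"
      using alpha_A_right[of \<epsilon> p] \<epsilon> \<epsilon>s p False by (simp add: d_def)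
    show "(1 - w) * ?A + w * ?B \<le> - \<epsilon>\<^sup>2"
    proof (cases "p \<le> s + 1 / 50")
      case True
      have "2 * d * (3 * \<epsilon> - 2 * d) = 9 / 4 * \<epsilon>\<^sup>2 - (2 * d - 3 / 2 * \<epsilon>)\<^sup>2"
        by (simp add: power2_eq_square algebra_simps)
      then have "2 * d * (3 * \<epsilon> - 2 * d) \<le> 3 * \<epsilon>\<^sup>2"
        using zero_le_power2[of \<epsilon>] zero_le_power2[of "2 * d - 3 / 2 * \<epsilon>"] by linarith
      with A have "?A \<le> 3 * \<epsilon>\<^sup>2" by linarith
      moreover have "\<bar>p - s\<bar> \<le> 1 / 50" using True False \<epsilon>s by linarith
      ultimately show ?thesis by (rule near)
    next
      case far_right: False
      have "2 * d * (3 * \<epsilon> - 2 * d) \<le> 2 * d * (- 1 / 50)"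
        using d far_right \<epsilon> \<epsilon>s by (intro mult_left_mono) (auto simp: d_def)
      moreover have "1 / 50 \<le> d" "\<epsilon> \<le> 1 / 50" using far_right \<epsilon> \<epsilon>s by (auto simp: d_def)
      ultimately show ?thesis using A \<epsilon>s by (intro far) linarith
    qed
  qed
qed

text \<open>
  For \<open>q = s - \<epsilon>\<close> the expected stakes factor against \<open>A\<close> is \<open>2 - 2 * q - p * (1 - 2 * q\<^sup>2)\<close>. As
  \<open>2 * q\<^sup>2 \<le> 1\<close>, it is largest at \<open>p = 0\<close>, with a value close to \<open>2 - sqrt 2\<close>;
  the bounded factor against \<open>B\<close> enters with a small weight only.
\<close>

lemma beta_mixture_le:
  assumes w: "0 \<le> w" "w \<le> 1 / 10" and \<epsilon>: "0 < \<epsilon>" "\<epsilon> \<le> 1 / 200" and p: "p \<in> {0..1}"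
  shows "(1 - w) * beta p (s - \<epsilon>) (s - \<epsilon>) + w * beta p 0 (s + 1 / 10) \<le> 9 / 10"
proof -
  have "(s - \<epsilon>)\<^sup>2 \<le> s\<^sup>2" using s \<epsilon> by (intro power_mono) auto
  then have "p * (2 * (s - \<epsilon>)\<^sup>2) \<le> p * 1" using p s2 by (intro mult_left_mono) auto
  then have "beta p (s - \<epsilon>) (s - \<epsilon>) \<le> 7 / 10"
    using p s \<epsilon> by (subst beta_eq) (auto simp: power2_eq_square algebra_simps)
  then have "(1 - w) * beta p (s - \<epsilon>) (s - \<epsilon>) \<le> 1 * (7 / 10)"
    using w by (intro order.trans[OF mult_left_mono mult_right_mono]) auto
  moreover have "beta p 0 (s + 1 / 10) \<le> 2" using p s by (subst beta_eq) auto
  then have "w * beta p 0 (s + 1 / 10) \<le> (1 / 10) * 2"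
    using w by (intro order.trans[OF mult_left_mono mult_right_mono]) auto
  ultimately show ?thesis by simp
qed

end

theorem corollary6p13:
  "\<exists>\<delta>::real. \<delta> > 0 \<and> (\<exists>\<beta>\<^sub>0::real. \<beta>\<^sub>0 < 1 \<and>
     (\<forall>\<^sub>F C::real in at_top. \<forall>\<^sub>F \<epsilon>::real in at_right 0.
        (let A = (1 / sqrt 2 - \<epsilon>, 1 / sqrt 2 - \<epsilon>);
             B = (0, 1 / sqrt 2 + \<delta>);
             \<nu> = mix (C * \<epsilon>\<^sup>2) A B
         in C * \<epsilon>\<^sup>2 \<le> 1 \<and>
            (\<forall>p\<in>{0..1}. alpha_mixed p \<nu> < 0 \<and> beta_mixed p \<nu> \<le> \<beta>\<^sub>0) \<and>
            winning_strategy \<nu>)))"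
proof -
  define s :: real where "s = 1 / sqrt 2"
  have s2: "2 * s\<^sup>2 = 1" by (simp add: s_def power_divide)
  have s: "7 / 10 < s" "s < 71 / 100"
    unfolding s_def by (rule inverse_sqrt_2_bounds)+
  have main: "C * \<epsilon>\<^sup>2 \<le> 1 \<and>
      (\<forall>p\<in>{0..1}. alpha_mixed p \<nu> < 0 \<and> beta_mixed p \<nu> \<le> 9 / 10) \<and> winning_strategy \<nu>"
    if C: "C \<ge> 200" and \<epsilon>: "0 < \<epsilon>" "(2 * C + 1) * \<epsilon> \<le> 1 / 100"
      and \<nu>: "\<nu> = mix (C * \<epsilon>\<^sup>2) (s - \<epsilon>, s - \<epsilon>) (0, s + 1 / 10)" for C \<epsilon> :: real and \<nu>
  proof -
    have "401 * \<epsilon> \<le> (2 * C + 1) * \<epsilon>"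
      using C \<epsilon> by (intro mult_right_mono) auto
    with \<epsilon> have \<epsilon>s: "\<epsilon> \<le> 1 / 200" by linarith
    have "C * \<epsilon> \<le> 1 / 100" using C \<epsilon> by (simp add: algebra_simps)
    then have "C * \<epsilon> * \<epsilon> \<le> 1 / 100 * 1"
      using C \<epsilon> \<epsilon>s by (intro mult_mono) auto
    then have w: "0 \<le> C * \<epsilon>\<^sup>2" "C * \<epsilon>\<^sup>2 \<le> 1 / 10"
      using C by (auto simp: power2_eq_square)
    have alpha: "alpha_mixed p \<nu> \<le> - \<epsilon>\<^sup>2" if "p \<in> {0..1}" for p
      using alpha_mixture_le[OF s2 s C \<epsilon> that] w
      unfolding alpha_mixed_def \<nu> by (subst integral_mix) (auto simp: measurable_alpha)
    have beta: "beta_mixed p \<nu> \<le> 9 / 10" if "p \<in> {0..1}" for p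
      using beta_mixture_le[OF s2 s w \<epsilon>(1) \<epsilon>s that] w
      unfolding beta_mixed_def \<nu> by (subst integral_mix) (auto simp: measurable_beta)
    have "mixed_strategy \<nu>"
      unfolding \<nu> using s \<epsilon> \<epsilon>s by (intro mixed_strategy_mix) auto
    then have "winning_strategy \<nu>"
      using \<epsilon>(1) alpha order.trans[OF beta] by (intro winning_strategyI[of \<nu> "\<epsilon>\<^sup>2"]) auto
    moreover have "alpha_mixed p \<nu> < 0" if "p \<in> {0..1}" for p
      using alpha[OF that] \<epsilon>(1) by (smt (verit) zero_less_power)
    ultimately show ?thesis using w beta by auto
  qed
  have "\<forall>\<^sub>F C::real in at_top. \<forall>\<^sub>F \<epsilon>::real in at_right 0. C \<ge> 200 \<and> 0 < \<epsilon> \<and> (2 * C + 1) * \<epsilon> \<le> 1 / 100"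
    using eventually_ge_at_top[of 200]
  proof eventually_elim
    case (elim C)
    then have "0 < 1 / (100 * (2 * C + 1))" by simp
    from eventually_at_right_less[of 0] eventually_at_right_real[OF this] show ?case
      by eventually_elim (use elim in \<open>auto simp: field_simps\<close>)
  qed
  then have "\<forall>\<^sub>F C::real in at_top. \<forall>\<^sub>F \<epsilon>::real in at_right 0.
        (let A = (1 / sqrt 2 - \<epsilon>, 1 / sqrt 2 - \<epsilon>);
             B = (0, 1 / sqrt 2 + 1 / 10);
             \<nu> = mix (C * \<epsilon>\<^sup>2) A B
         in C * \<epsilon>\<^sup>2 \<le> 1 \<and>
            (\<forall>p\<in>{0..1}. alpha_mixed p \<nu> < 0 \<and> beta_mixed p \<nu> \<le> 9 / 10) \<and>
            winning_strategy \<nu>)"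
    unfolding s_def[symmetric] Let_def
    by (elim eventually_mono) (use main in blast)
  then show ?thesis
    by (intro exI[of _ "1 / 10"] conjI exI[of _ "9 / 10"]) auto
qed

end
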